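(* The point $x_1/\lambda$ belongs to the boundary of $\widehat W$, and the arcs $\gamma_1/\lambda$ and $\gamma_2/\lambda$, which both land at $x_1/\lambda$, are contained in $\widehat W$. Moreover, they do not belong to the same access to $x_1/\lambda$ in $\widehat W$.
   Context: Let $\ell\geq 2$ be an even integer. Let $f$ be the real analytic function which near $0$ coincides with the real fixed point of period-doubling renormalization with critical point of degree $\ell$. With $\lambda=-f(f(0))\in(0,1)$, it satisfies the Cvitanović–Feigenbaum equation: $f(z)=-\frac1\lambda f(f(\lambda z))$ near $0$; $f(0)=1$; and $f(z)=F(z^\ell)$, where $F^{-1}$ is defined and univalent on $\mathbb C_\lambda=\mathbb C\setminus(]-\infty,-1/\lambda]\cup[1/\lambda^2,+\infty[)$. An analytic extension of $f$ is a holomorphic function on a connected open subset of $\mathbb C$ which agrees with $f$ on some nonempty open set. It is known that $f$ has a unique maximal analytic extension $\hat f:\widehat W\to\mathbb C$, i.e. one of which all analytic extensions are restrictions, and that $\widehat W$ is a simply connected open subset of $\mathbb C$. Let $\mathbb H_\pm$ be the upper/lower half-planes, $\mathcal W=F^{-1}(\mathbb C_\lambda)$, $W=\{z: z^\ell\in\mathcal W\}$, $W_+=W\cap\{z:0<\operatorname{Arg}(z)<\pi/\ell\}$. It is known (Epstein) that $\mathcal W$ is bounded, that $F^{-1}|_{\mathbb H_-}$ extends continuously and injectively to $\overline{\mathbb H_-}$, and that $F^{-1}(z)$ tends to a point of $\mathbb H_+$, denoted $F^{-1}(-i\infty)$, as $z\to\infty$ in $\mathbb H_-$. The map $f$ sends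 $W_+$ isomorphically onto $\mathbb H_-$, and the boundary $\partial W_+$ is the union of: an arc $\gamma_1$ mapped by $\hat f$ to $\mathbb R_+$ (the half-line of nonnegative reals), an arc $\gamma_2$ mapped by $\hat f$ to $\mathbb R_-$ (the half-line of nonpositive reals), and the point $x_1\in\partial W_+$ with $(x_1)^\ell=F^{-1}(-i\infty)$. Both arcs land at (i.e. converge to) $x_1$. For a set $A$, $A/\lambda=\{z/\lambda: z\in A\}$. Two arcs in $\widehat W$ landing at the same boundary point $a\in\partial\widehat W$ belong to the same access to $a$ if they are homotopic through arcs in $\widehat W$ landing at $a$: i.e., parametrizing them by $[0,1[$ and extending by the value $a$ at $1$, there is a continuous homotopy $H:[0,1]\times[0,1]\to\widehat W\cup\{a\}$ between them with $H(s,t)\in\widehat W$ for $t<1$ and $H(s,1)=a$ for all $s$. *)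

theory Defs
  imports "HOL-Complex_Analysis.Complex_Analysis"
begin

section \<open>Fixed points of period-doubling renormalization\<close>

text \<open>
  Unimodal maps are normalised by \<open>g 0 = 1\<close>; only the values of \<open>g\<close> on \<open>[-1,1]\<close> matter.
\<close>

definition analytic_unimodal :: "nat \<Rightarrow> (real \<Rightarrow> real) \<Rightarrow> bool" where
  "analytic_unimodal l g \<longleftrightarrow>
     g 0 = 1 \<and> g ` {-1..1} \<subseteq> {-1..1} \<and>
     strict_mono_on {-1..0} g \<and> strict_antimono_on {0..1} g \<and>
     (\<exists>U h. open U \<and> complex_of_real ` {-1..1} \<subseteq> U \<and> h holomorphic_on U \<and>
        (\<forall>x\<in>{-1..1}. h (complex_of_real x) = complex_of_real (g x))) \<and>
     (\<exists>c. c \<noteq> 0 \<and> ((\<lambda>x. (g x - g 0) / x ^ l) \<longlongrightarrow> c) (at 0))"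

definition pd_ratio :: "(real \<Rightarrow> real) \<Rightarrow> real" where
  "pd_ratio g = - g (g 0)"

definition pd_renormalizable :: "(real \<Rightarrow> real) \<Rightarrow> bool" where
  "pd_renormalizable g \<longleftrightarrow>
     0 < pd_ratio g \<and> pd_ratio g < 1 \<and>
     g ` {- pd_ratio g..pd_ratio g} \<inter> {- pd_ratio g..pd_ratio g} = {} \<and>
     g ` g ` {- pd_ratio g..pd_ratio g} \<subseteq> {- pd_ratio g..pd_ratio g}"

definition pd_renorm :: "(real \<Rightarrow> real) \<Rightarrow> real \<Rightarrow> real" where
  "pd_renorm g x = - (1 / pd_ratio g) * g (g (pd_ratio g * x))"

definition pd_fixed_point :: "nat \<Rightarrow> (real \<Rightarrow> real) \<Rightarrow> bool" where
  "pd_fixed_point l g \<longleftrightarrow>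
     analytic_unimodal l g \<and> pd_renormalizable g \<and> (\<forall>x\<in>{-1..1}. pd_renorm g x = g x)"


section \<open>The domains\<close>

definition slit_plane :: "real \<Rightarrow> complex set" where
  "slit_plane lam = - (complex_of_real ` ({..- (1 / lam)} \<union> {1 / lam\<^sup>2..}))"

text \<open>
  In the next three definitions \<open>Finv\<close> stands for the univalent map \<open>F\<^sup>-\<^sup>1\<close> on
  \<^term>\<open>slit_plane lam\<close>; its values outside that set are irrelevant.
\<close>

definition feig_calW :: "real \<Rightarrow> (complex \<Rightarrow> complex) \<Rightarrow> complex set" where
  "feig_calW lam Finv = Finv ` slit_plane lam"

definition feig_W :: "nat \<Rightarrow> real \<Rightarrow> (complex \<Rightarrow> complex) \<Rightarrow> complex set" where
  "feig_W l lam Finv = {z. z ^ l \<in> feig_calW lam Finv}"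

definition feig_W_plus :: "nat \<Rightarrow> real \<Rightarrow> (complex \<Rightarrow> complex) \<Rightarrow> complex set" where
  "feig_W_plus l lam Finv = feig_W l lam Finv \<inter> {z. 0 < Arg z \<and> Arg z < pi / real l}"

text \<open>
  The map \<open>f\<close> is a total function, but it is only meaningful on \<^term>\<open>feig_W l lam Finv\<close>, where
  it is \<open>F (z ^ l)\<close>. The conditions that \<open>0\<close> and \<open>1\<close> lie in this set make \<open>f\<close> defined near \<open>0\<close>
  and near \<open>f 0\<close>, so that the functional equation and \<open>f (f 0)\<close> make sense.
\<close>

definition feigenbaum_map ::
  "nat \<Rightarrow> real \<Rightarrow> (complex \<Rightarrow> complex) \<Rightarrow> (complex \<Rightarrow> complex) \<Rightarrow> (complex \<Rightarrow> complex) \<Rightarrow> bool" where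
  "feigenbaum_map l lam f F Finv \<longleftrightarrow>
     (\<exists>g. pd_fixed_point l g \<and>
        (\<forall>\<^sub>F x in nhds 0. f (complex_of_real x) = complex_of_real (g x))) \<and>
     Finv holomorphic_on slit_plane lam \<and> inj_on Finv (slit_plane lam) \<and>
     (\<forall>w\<in>slit_plane lam. F (Finv w) = w) \<and>
     0 \<in> feig_W l lam Finv \<and> 1 \<in> feig_W l lam Finv \<and>
     (\<forall>z\<in>feig_W l lam Finv. f z = F (z ^ l)) \<and>
     f 0 = 1 \<and>
     0 < lam \<and> lam < 1 \<and> complex_of_real lam = - f (f 0) \<and>
     (\<forall>\<^sub>F z in nhds 0. f z = - (1 / complex_of_real lam) * f (f (complex_of_real lam * z)))"


section \<open>Analytic extensions\<close>

definition analytic_extension ::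
  "complex set \<Rightarrow> (complex \<Rightarrow> complex) \<Rightarrow> complex set \<Rightarrow> (complex \<Rightarrow> complex) \<Rightarrow> bool" where
  "analytic_extension D f U h \<longleftrightarrow>
     open U \<and> connected U \<and> h holomorphic_on U \<and>
     (\<exists>V. open V \<and> V \<noteq> {} \<and> V \<subseteq> D \<inter> U \<and> (\<forall>z\<in>V. h z = f z))"

definition maximal_analytic_extension ::
  "complex set \<Rightarrow> (complex \<Rightarrow> complex) \<Rightarrow> complex set \<Rightarrow> (complex \<Rightarrow> complex) \<Rightarrow> bool" where
  "maximal_analytic_extension D f U h \<longleftrightarrow>
     analytic_extension D f U h \<and>
     (\<forall>U' h'. analytic_extension D f U' h' \<longrightarrow> U' \<subseteq> U \<and> (\<forall>z\<in>U'. h' z = h z))"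


section \<open>Arcs and accesses\<close>

text \<open>
  An arc parametrized by \<open>[0,1[\<close> and landing at \<open>a\<close> is represented by its extension to \<open>[0,1]\<close>
  with value \<open>a\<close> at \<open>1\<close>.
\<close>

definition landing_arc :: "complex set \<Rightarrow> complex \<Rightarrow> (real \<Rightarrow> complex) \<Rightarrow> bool" where
  "landing_arc U a p \<longleftrightarrow> arc p \<and> p ` {0..<1} \<subseteq> U \<and> pathfinish p = a"

text \<open>
  The intermediate curves need not be injective, and their starting points may move inside \<open>U\<close>.
\<close>

definition same_access ::
  "complex set \<Rightarrow> complex \<Rightarrow> (real \<Rightarrow> complex) \<Rightarrow> (real \<Rightarrow> complex) \<Rightarrow> bool" where
  "same_access U a p q \<longleftrightarrow>
     homotopic_with_canon (\<lambda>r. r ` {0..<1} \<subseteq> U \<and> pathfinish r = a) {0..1} (insert a U) p q"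

end

theory Submission
  imports Defs
begin

text \<open>
  Let \<open>\<psi>\<close> be the inverse of \<open>f\<close> on \<open>W\<^sub>+\<close>, extended continuously to the real axis, which it maps onto
  \<open>\<partial>W\<^sub>+\<close> without \<open>x\<^sub>1\<close>. The functional equation extends \<open>f\<close> first to the real line and then along
  \<open>\<psi>(\<real>)/\<lambda>\<close>, so both scaled arcs lie in the maximal domain. They bound the Jordan domain \<open>W\<^sub>+/\<lambda>\<close>.
  If they defined the same access, or if \<open>x\<^sub>1/\<lambda>\<close> were in the maximal domain, then, this domain being
  simply connected, winding numbers would show that it contains all of \<open>W\<^sub>+/\<lambda>\<close>. In that case
  \<open>w \<mapsto> -\<lambda> f(\<psi>(w)/\<lambda>)\<close> would extend \<open>f\<close> to the lower half-plane and, \<open>f\<close> being even, also to the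
  upper one, which contains \<open>x\<^sub>1\<close>. But \<open>f\<close> is unbounded along the arc \<open>\<gamma>\<^sub>1\<close> landing at \<open>x\<^sub>1\<close>.
\<close>

section \<open>Winding numbers and accesses\<close>

lemma landing_arcD:
  assumes "landing_arc U a p"
  shows "arc p" "path p" "continuous_on {0..1} p" "inj_on p {0..1}" "p ` {0..<1} \<subseteq> U" "p 1 = a"
  using assms by (simp_all only: landing_arc_def arc_def path_def pathfinish_def)

text \<open>The square is contractible, so \<open>h - \<zeta>\<close> has a continuous logarithm on
  it. The winding number of a side, closed or not, is the increment of this logarithm divided by
  \<open>2 * pi * \<i>\<close>, and both routes from \<open>(0, 0)\<close> to \<open>(1, 1)\<close>
  have the same total increment.\<close>

lemma winding_number_square:
  fixes h :: "real \<times> real \<Rightarrow> complex"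
  assumes cont: "continuous_on ({0..1} \<times> {0..1}) h"
    and avoid: "\<zeta> \<notin> h ` ({0..1} \<times> {0..1})"
  shows "winding_number (\<lambda>s. h (s, 0)) \<zeta> + winding_number (\<lambda>t. h (1, t)) \<zeta> =
         winding_number (\<lambda>t. h (0, t)) \<zeta> + winding_number (\<lambda>s. h (s, 1)) \<zeta>"
proof -
  let ?Q = "{0..1} \<times> {0..1} :: (real \<times> real) set"
  have contr: "contractible ?Q"
    by (intro convex_imp_contractible convex_Times) auto
  have cont': "continuous_on ?Q (\<lambda>z. h z - \<zeta>)"
    by (intro continuous_intros cont)
  have nz: "h z - \<zeta> \<noteq> 0" if "z \<in> ?Q" for z
    using avoid that by auto
  have "\<exists>g. continuous_on ?Q g \<and> (\<forall>z\<in>?Q. h z - \<zeta> = exp (g z))"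
    by (rule continuous_logarithm_on_contractible[OF cont' contr nz]) blast+
  then obtain g where g: "continuous_on ?Q g" "\<And>z. z \<in> ?Q \<Longrightarrow> h z - \<zeta> = exp (g z)"
    by blast
  have side: "winding_number (h \<circ> \<gamma>) \<zeta> = (g (\<gamma> 1) - g (\<gamma> 0)) / (2 * of_real pi * \<i>)"
    if \<gamma>: "continuous_on {0..1} \<gamma>" "\<gamma> ` {0..1} \<subseteq> ?Q" for \<gamma> :: "real \<Rightarrow> real \<times> real"
  proof -
    have "winding_number (h \<circ> \<gamma>) \<zeta> = winding_number (\<lambda>t. (h \<circ> \<gamma>) t - \<zeta>) 0"
      by (rule winding_number_offset)
    also have "\<dots> = winding_number (exp \<circ> (g \<circ> \<gamma>)) 0"
    proof (rule winding_number_cong)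
      fix t :: real assume "0 \<le> t" "t \<le> 1"
      then have "\<gamma> t \<in> ?Q"
        by (intro subsetD[OF \<gamma>(2)]) simp
      then show "(h \<circ> \<gamma>) t - \<zeta> = (exp \<circ> (g \<circ> \<gamma>)) t"
        by (simp only: o_apply g(2))
    qed
    also have "\<dots> = (g (\<gamma> 1) - g (\<gamma> 0)) / (2 * of_real pi * \<i>)"
    proof -
      have "path (g \<circ> \<gamma>)"
        unfolding path_def by (rule continuous_on_compose[OF \<gamma>(1) continuous_on_subset[OF g(1) \<gamma>(2)]])
      from winding_number_compose_exp[OF this] show ?thesis
        by (simp add: pathfinish_def pathstart_def)
    qed
    finally show ?thesis .
  qed
  have c: "continuous_on {0..1} (\<lambda>s::real. (s, a::real))" "continuous_on {0..1} (\<lambda>s::real. (a, s))" for a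
    by (intro continuous_intros)+
  have im: "(\<lambda>s. (s, a)) ` {0..1} \<subseteq> ?Q" "(\<lambda>s. (a, s)) ` {0..1} \<subseteq> ?Q"
    if "a \<in> {0..1}" for a
    using that by auto
  have "winding_number (\<lambda>s. h (s, 0)) \<zeta> = (g (1, 0) - g (0, 0)) / (2 * of_real pi * \<i>)"
       "winding_number (\<lambda>t. h (1, t)) \<zeta> = (g (1, 1) - g (1, 0)) / (2 * of_real pi * \<i>)"
       "winding_number (\<lambda>t. h (0, t)) \<zeta> = (g (0, 1) - g (0, 0)) / (2 * of_real pi * \<i>)"
       "winding_number (\<lambda>s. h (s, 1)) \<zeta> = (g (1, 1) - g (0, 1)) / (2 * of_real pi * \<i>)"
    using side[OF c(1) im(1), of 0] side[OF c(2) im(2), of 1]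
      side[OF c(2) im(2), of 0] side[OF c(1) im(1), of 1]
    by (simp_all add: o_def)
  then show ?thesis
    by (simp add: diff_divide_distrib)
qed

text \<open>The homotopy is a square with \<open>p\<close> and \<open>q\<close> as opposite sides.
  The starting points trace a loop in the simply connected \<open>U\<close>, which does not wind
  around \<open>\<zeta>\<close>, and the end points stay at \<open>a\<close>; so \<open>p\<close>
  and \<open>q\<close> have equal winding numbers by \<open>winding_number_square\<close>.\<close>

lemma same_access_imp_winding_number_zero:
  assumes same: "same_access U a p q" and U: "simply_connected U"
    and p: "landing_arc U a p" and q: "landing_arc U a q"
    and start: "p 0 = q 0" and \<zeta>: "\<zeta> \<notin> U" "\<zeta> \<noteq> a"
  shows "winding_number (p +++ reversepath q) \<zeta> = 0"
proof -
  have "\<exists>h :: real \<times> real \<Rightarrow> complex. continuous_on ({0..1} \<times> {0..1}) h \<and> h ` ({0..1} \<times> {0..1}) \<subseteq> insert a U \<and>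
          (\<forall>t. h (0, t) = p t) \<and> (\<forall>t. h (1, t) = q t) \<and>
          (\<forall>s\<in>{0..1}. (\<lambda>t. h (s, t)) ` {0..<1} \<subseteq> U \<and> h (s, 1) = a)"
    using same unfolding same_access_def homotopic_with_def pathfinish_def
    by (simp add: prod_topology_subtopology_eu image_subset_iff_funcset)
  then obtain h :: "real \<times> real \<Rightarrow> complex" where h: "continuous_on ({0..1} \<times> {0..1}) h"
      "h ` ({0..1} \<times> {0..1}) \<subseteq> insert a U"
      "\<And>t. h (0, t) = p t" "\<And>t. h (1, t) = q t"
      "\<And>s. s \<in> {0..1} \<Longrightarrow> (\<lambda>t. h (s, t)) ` {0..<1} \<subseteq> U \<and> h (s, 1) = a"
    by metis
  have avoid: "\<zeta> \<notin> h ` ({0..1} \<times> {0..1})"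
    using h(2) \<zeta> by auto
  have pq: "path p" "path q" "pathfinish p = a" "pathfinish q = a"
    using p q by (auto simp: landing_arc_def arc_def)
  have "h (0, t) \<noteq> \<zeta>" "h (1, t) \<noteq> \<zeta>" if "t \<in> {0..1}" for t
    using avoid that by auto
  then have im: "\<zeta> \<notin> path_image p" "\<zeta> \<notin> path_image q"
    unfolding h(3,4) path_image_def by blast+
  have "winding_number (\<lambda>s. h (s, 0)) \<zeta> = 0"
  proof (rule simply_connected_imp_winding_number_zero[OF U])
    show "path (\<lambda>s. h (s, 0))"
      unfolding path_def by (rule continuous_on_compose2[OF h(1)]) (auto intro!: continuous_intros)
    show "path_image (\<lambda>s. h (s, 0)) \<subseteq> U"
      using h(5) by (fastforce simp: path_image_def image_subset_iff)
    show "pathfinish (\<lambda>s. h (s, 0)) = pathstart (\<lambda>s. h (s, 0))"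
      using start by (simp add: pathfinish_def pathstart_def h)
  qed (rule \<zeta>(1))
  moreover have "winding_number (\<lambda>s. h (s, 1)) \<zeta> = 0"
  proof -
    have "winding_number (\<lambda>s. h (s, 1)) \<zeta> = winding_number (linepath a a) \<zeta>"
      by (rule winding_number_cong) (use h(5) in \<open>auto simp: linepath_def algebra_simps\<close>)
    then show ?thesis
      using \<zeta>(2) by (simp add: winding_number_trivial)
  qed
  ultimately have "winding_number p \<zeta> = winding_number q \<zeta>"
    using winding_number_square[OF h(1) avoid] by (simp add: h(3,4))
  then show ?thesis
    using pq im by (simp add: winding_number_join winding_number_reversepath)
qed

section \<open>Preimages under powers, frontiers, and monotone functions\<close>

text \<open>The power map is open and proper, so it sends a nonempty relatively clopen part of the
  preimage onto a clopen subset of \<open>S\<close>, hence onto \<open>S\<close>. Such a part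
  contains \<open>0\<close>, the only root of \<open>0\<close>, and two disjoint parts cannot both
  do so.\<close>

lemma connected_power_preimage:
  fixes S :: "complex set"
  assumes S: "open S" "connected S" "0 \<in> S" and n: "n > 0"
  shows "connected {z. z ^ n \<in> S}"
proof (rule ccontr)
  let ?P = "{z. z ^ n \<in> S}"
  assume "\<not> connected ?P"
  moreover have "open ?P"
    using open_vimage[OF S(1), of "\<lambda>z. z ^ n"] by (simp add: vimage_def continuous_on_power)
  ultimately obtain A B where AB: "open A" "open B" "A \<inter> B = {}" "A \<union> B = ?P" "A \<noteq> {}" "B \<noteq> {}"
    by (auto simp: connected_openin_eq openin_open_eq)
  have *: "0 \<in> X" if X: "open X" "open Y" "X \<inter> Y = {}" "X \<union> Y = ?P" "X \<noteq> {}" for X Y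
  proof -
    let ?I = "(\<lambda>z. z ^ n) ` X"
    have I: "?I \<subseteq> S" using X(4) by auto
    have "open ?I"
    proof (rule open_mapping_thm[of "\<lambda>z. z ^ n" UNIV])
      show "\<not> (\<lambda>z::complex. z ^ n) constant_on UNIV"
        using n by (metis UNIV_I constant_on_def power_one zero_power zero_neq_one)
    qed (use X in \<open>auto intro!: holomorphic_intros\<close>)
    \<comment> \<open>This is properness: roots of a convergent sequence are bounded, so a
      subsequence converges, and its limit stays in \<open>X\<close> because the complementary part
      \<open>Y\<close> is open.\<close>
    moreover have "closedin (top_of_set S) ?I"
      unfolding closedin_limpt islimpt_sequential
    proof (intro conjI allI impI I)
      fix q assume "(\<exists>x. (\<forall>k. x k \<in> ?I - {q}) \<and> x \<longlonglongrightarrow> q) \<and> q \<in> S"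
      then obtain x where xq: "(\<forall>k. x k \<in> ?I) \<and> q \<in> S \<and> x \<longlonglongrightarrow> q"
        by blast
      then have "\<forall>k. \<exists>b\<in>X. x k = b ^ n"
        by blast
      then obtain b where b: "\<And>k. b k \<in> X" "\<And>k. x k = b k ^ n"
        by metis
      obtain M where M: "\<And>k. norm (x k) \<le> M" 
        using xq convergent_imp_bounded[of x q] by (auto simp: bounded_iff)
      have "norm (b k) \<le> max 1 M" for k
      proof (cases "norm (b k) \<le> 1")
        case False
        then have "norm (b k) ^ 1 \<le> norm (b k) ^ n"
          using n by (intro power_increasing) auto
        with M[of k] b(2)[of k] show ?thesis by (simp add: norm_power)
      qed auto
      then have "bounded (range b)" by (auto simp: bounded_iff)
      then obtain c r where cr: "strict_mono r" "(b \<circ> r) \<longlonglongrightarrow> c"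
        using bounded_imp_convergent_subsequence by blast
      have "(\<lambda>k. (b \<circ> r) k ^ n) \<longlonglongrightarrow> c ^ n"
        by (intro tendsto_intros cr)
      moreover have "(\<lambda>k. (b \<circ> r) k ^ n) \<longlonglongrightarrow> q"
        using LIMSEQ_subseq_LIMSEQ[of x q r] xq cr b(2) by (simp add: o_def)
      ultimately have "c ^ n = q" by (rule LIMSEQ_unique)
      then have "c \<in> X \<union> Y" using xq X(4) by simp
      moreover have "c \<notin> Y"
      proof
        assume "c \<in> Y"
        then have "\<forall>\<^sub>F k in sequentially. (b \<circ> r) k \<in> Y"
          by (rule topological_tendstoD[OF cr(2) X(2)])
        then obtain k where "(b \<circ> r) k \<in> Y"
          by (auto simp: eventually_sequentially)
        moreover have "(b \<circ> r) k \<in> X"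
          by (simp add: b(1))
        ultimately show False
          using X(3) by blast
      qed
      ultimately show "q \<in> ?I" using \<open>c ^ n = q\<close> by auto
    qed
    ultimately have "?I = S"
      using S(2) X(5) open_subset[OF I] unfolding connected_clopen by (metis image_is_empty)
    then obtain z where "z \<in> X" "z ^ n = 0" using S(3) by force
    then show ?thesis using n by (simp add: power_eq_0_iff)
  qed
  have "0 \<in> A"
    using AB(1-5) by (rule *)
  moreover have "0 \<in> B"
    by (rule *[OF AB(2,1)]) (use AB(3,4,6) in blast)+
  ultimately show False
    using AB(3) by blast
qed

lemma subset_if_disjoint_frontier:
  assumes "connected K" "x \<in> K" "x \<in> S" "K \<inter> frontier S = {}"
  shows "K \<subseteq> S"
  using connected_Int_frontier[OF assms(1), of S] assms(2-4) by blast

text \<open>The component of \<open>x\<close> in the complement of the frontier cannot leave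
  \<open>S\<close>, so it is bounded.\<close>

lemma inside_frontier:
  fixes S :: "'a::real_normed_vector set"
  assumes "bounded S" "x \<in> S" "x \<notin> frontier S"
  shows "x \<in> inside (frontier S)"
proof -
  have "connected_component_set (- frontier S) x \<subseteq> S"
    by (rule subset_if_disjoint_frontier[where x = x])
      (use assms connected_component_subset[of "- frontier S" x] in \<open>auto simp: connected_component_refl_eq\<close>)
  then show ?thesis
    using assms bounded_subset unfolding inside_def by blast
qed

text \<open>Continuous injective functions on compact intervals are strictly monotone, so they have
  no interior minimum. This serves to find the starting points of the two arcs.\<close>

lemma inj_on_half_open_min_at_0:
  fixes \<phi> :: "real \<Rightarrow> real"
  assumes cont: "continuous_on {0..<1} \<phi>" and inj: "inj_on \<phi> {0..<1}"
    and t: "t \<in> {0..<1}" and min: "\<And>s. s \<in> {0..<1} \<Longrightarrow> \<phi> t \<le> \<phi> s"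
  shows "t = 0"
proof (rule ccontr)
  assume "t \<noteq> 0"
  define b where "b = (1 + t) / 2"
  have b: "0 < t" "t < b" "b < 1"
    using t \<open>t \<noteq> 0\<close> by (auto simp: b_def)
  then have sub: "{0..b} \<subseteq> {0..<1}" by auto
  have "(\<phi> 0 < \<phi> t \<and> \<phi> t < \<phi> b) \<or> (\<phi> b < \<phi> t \<and> \<phi> t < \<phi> 0)"
    using continuous_inj_imp_mono[OF b(1,2) continuous_on_subset[OF cont sub] inj_on_subset[OF inj sub]] .
  then show False
    using min[of 0] min[of b] b by auto
qed

lemma frontier_scaled:
  assumes "c \<noteq> (0::complex)"
  shows "frontier ((\<lambda>z. z / c) ` S) = (\<lambda>z. z / c) ` frontier S"
proof -
  have lin: "linear (\<lambda>z. z / c)" and inj: "inj (\<lambda>z. z / c)"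
    using assms by (auto intro: bounded_linear.linear bounded_linear_divide simp: inj_def)
  show ?thesis
    unfolding frontier_def
    by (simp add: closure_injective_linear_image[OF lin inj] interior_injective_linear_image[OF lin inj]
        image_set_diff[OF inj])
qed

section \<open>The extension along the real line\<close>

lemma open_slit_plane: "open (slit_plane lam)"
proof -
  have "closed (complex_of_real ` ({..- (1 / lam)} \<union> {1 / lam\<^sup>2..}))"
    by (intro closed_injective_linear_image) (auto intro: bounded_linear.linear bounded_linear_of_real simp: inj_def)
  then show ?thesis
    by (simp add: slit_plane_def open_Compl)
qed

text \<open>The set is starlike about \<open>0\<close>: dividing a point of a slit by some
  \<open>u\<close> with \<open>0 < u \<le> 1\<close> moves it outwards along the same slit.\<close>

lemma connected_slit_plane:
  assumes "0 < lam"
  shows "connected (slit_plane lam)"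
proof (rule starlike_imp_connected, unfold starlike_def, intro bexI[of _ 0] ballI)
  show "0 \<in> slit_plane lam"
    using assms by (auto simp: slit_plane_def)
  fix w assume w: "w \<in> slit_plane lam"
  show "closed_segment 0 w \<subseteq> slit_plane lam"
  proof
    fix z assume "z \<in> closed_segment 0 w"
    then obtain u where u: "0 \<le> u" "u \<le> 1" "z = of_real u * w"
      by (auto simp: in_segment scaleR_conv_of_real)
    show "z \<in> slit_plane lam"
    proof (rule ccontr)
      assume "z \<notin> slit_plane lam"
      then obtain r where r: "z = of_real r" "r \<le> - (1 / lam) \<or> r \<ge> 1 / lam\<^sup>2"
        by (auto simp: slit_plane_def)
      have pos: "1 / lam > 0" "1 / lam\<^sup>2 > 0"
        using assms by simp_all
      have "u \<noteq> 0"
        using r u pos by auto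
      with u have "u > 0" by simp
      then have w_eq: "w = of_real (r / u)"
        using r u by (simp add: field_simps)
      have "\<bar>r\<bar> \<le> \<bar>r / u\<bar>"
        using u \<open>u > 0\<close> by (simp add: field_simps mult_left_le_one_le)
      have "r / u \<le> - (1 / lam) \<or> r / u \<ge> 1 / lam\<^sup>2"
        using r(2)
      proof
        assume "r \<le> - (1 / lam)"
        moreover have "r < 0" using calculation pos by linarith
        moreover have "r / u < 0" using \<open>r < 0\<close> \<open>u > 0\<close> by (rule divide_neg_pos)
        ultimately show ?thesis using \<open>\<bar>r\<bar> \<le> \<bar>r / u\<bar>\<close> by linarith
      next
        assume "1 / lam\<^sup>2 \<le> r"
        moreover have "0 < r" using calculation pos by linarith
        moreover have "0 < r / u" using \<open>0 < r\<close> \<open>u > 0\<close> by (rule divide_pos_pos)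
        ultimately show ?thesis using \<open>\<bar>r\<bar> \<le> \<bar>r / u\<bar>\<close> by linarith
      qed
      then have "w \<notin> slit_plane lam"
        unfolding w_eq slit_plane_def by (auto simp del: of_real_divide)
      with w show False by simp
    qed
  qed
qed

section \<open>The domain \<open>W\<close> and continuation by the functional equation\<close>

locale feigenbaum_extension =
  fixes l :: nat and lam :: real and f F Finv fhat :: "complex \<Rightarrow> complex"
    and What :: "complex set"
  assumes even_l: "even l" and l_ge: "l \<ge> 2"
    and feig: "feigenbaum_map l lam f F Finv"
    and maximal: "maximal_analytic_extension (feig_W l lam Finv) f What fhat"
begin

abbreviation "W \<equiv> feig_W l lam Finv"
abbreviation "W_plus \<equiv> feig_W_plus l lam Finv"

lemma lam: "0 < lam" "lam < 1"
  using feig by (auto simp: feigenbaum_map_def)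

lemma f_0: "f 0 = 1"
  using feig by (auto simp: feigenbaum_map_def)

lemma zero_in_W: "0 \<in> W" and one_in_W: "1 \<in> W"
  using feig by (auto simp: feigenbaum_map_def)

lemma f_eq: "z \<in> W \<Longrightarrow> f z = F (z ^ l)"
  using feig by (auto simp: feigenbaum_map_def)

lemma F_Finv: "w \<in> slit_plane lam \<Longrightarrow> F (Finv w) = w"
  using feig by (auto simp: feigenbaum_map_def)

lemma functional_equation:
  "\<forall>\<^sub>F z in nhds 0. f z = - (1 / complex_of_real lam) * f (f (complex_of_real lam * z))"
  using feig by (auto simp: feigenbaum_map_def)

lemma W_iff: "z \<in> W \<longleftrightarrow> z ^ l \<in> feig_calW lam Finv"
  by (simp add: feig_W_def)

lemma uminus_in_W: "z \<in> W \<Longrightarrow> - z \<in> W"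
  using even_l by (simp add: W_iff)

lemma f_even: "z \<in> W \<Longrightarrow> f (- z) = f z"
  using even_l by (simp add: f_eq uminus_in_W)

lemma Finv_f: "z \<in> W \<Longrightarrow> z ^ l = Finv (f z) \<and> f z \<in> slit_plane lam"
  by (auto simp: f_eq W_iff feig_calW_def F_Finv)

lemma holomorphic_Finv: "Finv holomorphic_on slit_plane lam"
  and inj_Finv: "inj_on Finv (slit_plane lam)"
  using feig by (auto simp: feigenbaum_map_def)

lemma open_calW: "open (feig_calW lam Finv)"
  unfolding feig_calW_def
  by (rule open_mapping_thm3[OF holomorphic_Finv open_slit_plane inj_Finv])

lemma open_W: "open W"
  using open_vimage[OF open_calW, of "\<lambda>z. z ^ l"]
  by (simp add: feig_W_def vimage_def continuous_on_power)

text \<open>Connectedness is what makes \<open>W\<close> itself the domain of an analytic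
  extension.\<close>

lemma connected_W: "connected W"
  unfolding feig_W_def
proof (rule connected_power_preimage[OF open_calW])
  show "connected (feig_calW lam Finv)"
    unfolding feig_calW_def
    by (intro connected_continuous_image connected_slit_plane lam
        holomorphic_on_imp_continuous_on holomorphic_Finv)
  show "0 \<in> feig_calW lam Finv"
    using zero_in_W l_ge by (simp add: W_iff zero_power)
qed (use l_ge in simp)

text \<open>\<open>F\<close> is given only pointwise, as a left inverse of \<open>Finv\<close>. On
  the image of the slit plane it agrees with the holomorphic inverse \<open>G\<close> of the
  univalent \<open>Finv\<close>.\<close>

lemma holomorphic_f_W: "f holomorphic_on W"
proof -
  obtain G where G: "G holomorphic_on feig_calW lam Finv"
      "\<And>w. w \<in> slit_plane lam \<Longrightarrow> G (Finv w) = w"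
    unfolding feig_calW_def
    using holomorphic_has_inverse[OF holomorphic_Finv open_slit_plane inj_Finv] by metis
  have "(\<lambda>z. G (z ^ l)) holomorphic_on W"
    by (rule holomorphic_on_compose_gen[OF _ G(1), of "\<lambda>z. z ^ l", unfolded o_def])
      (auto intro!: holomorphic_intros simp: W_iff)
  then show ?thesis
    by (rule holomorphic_transform) (use Finv_f G(2) in metis)
qed

lemma open_What: "open What" and connected_What: "connected What"
  and holomorphic_fhat: "fhat holomorphic_on What"
  using maximal by (auto simp: maximal_analytic_extension_def analytic_extension_def)

lemma continuous_fhat: "continuous_on What fhat"
  by (rule holomorphic_on_imp_continuous_on[OF holomorphic_fhat])

text \<open>Maximality in the form in which every continuation below uses it: agreement with
  \<open>f\<close> on one small open set \<open>V\<close> suffices.\<close>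

lemma extensionD:
  assumes "open U" "connected U" "h holomorphic_on U" 
    and "open V" "V \<noteq> {}" "V \<subseteq> W" "V \<subseteq> U" "\<And>z. z \<in> V \<Longrightarrow> h z = f z"
  shows "U \<subseteq> What" "z \<in> U \<Longrightarrow> fhat z = h z"
proof -
  have "analytic_extension W f U h"
    using assms unfolding analytic_extension_def by blast
  then have "U \<subseteq> What \<and> (\<forall>z\<in>U. h z = fhat z)"
    using maximal unfolding maximal_analytic_extension_def by blast
  then show "U \<subseteq> What" "z \<in> U \<Longrightarrow> fhat z = h z"
    by auto
qed

lemma W_subset_What: "W \<subseteq> What" and fhat_eq_f: "z \<in> W \<Longrightarrow> fhat z = f z"
  using extensionD[OF open_W connected_W holomorphic_f_W open_W] zero_in_W by auto

lemma isCont_f_0: "isCont f 0"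
  using holomorphic_on_imp_continuous_on[OF holomorphic_f_W] open_W zero_in_W
  by (auto simp: continuous_on_eq_continuous_at)

text \<open>The right-hand side is holomorphic on the open set where both evaluations of
  \<open>fhat\<close> make sense. Near \<open>0\<close> it equals \<open>f\<close>, so maximality
  applies to the component of \<open>0\<close>, which contains the connected set
  \<open>T\<close>.\<close>

lemma functional_equation_extends:
  assumes T: "connected T" "0 \<in> T"
    and in_What: "\<And>z. z \<in> T \<Longrightarrow> of_real lam * z \<in> What \<and> fhat (of_real lam * z) \<in> What"
  shows "T \<subseteq> What" "z \<in> T \<Longrightarrow> fhat z = - (1 / of_real lam) * fhat (fhat (of_real lam * z))"
proof -
  define U where "U = {z. of_real lam * z \<in> What} \<inter> (\<lambda>z. fhat (of_real lam * z)) -` What"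
  define h where "h = (\<lambda>z. - (1 / of_real lam) * fhat (fhat (of_real lam * z)))"
  have dom: "open {z. complex_of_real lam * z \<in> What}"
    using open_vimage[OF open_What, of "\<lambda>z. complex_of_real lam * z"]
    by (simp add: vimage_def continuous_on_mult_left)
  have inner: "(\<lambda>z. fhat (of_real lam * z)) holomorphic_on {z. complex_of_real lam * z \<in> What}"
    by (rule holomorphic_on_compose_gen[OF _ holomorphic_fhat, of "\<lambda>z. of_real lam * z", unfolded o_def])
      (auto intro!: holomorphic_intros)
  have "open U"
    unfolding U_def
    by (rule continuous_open_preimage[OF holomorphic_on_imp_continuous_on[OF inner] dom open_What])
  have "(\<lambda>z. fhat (fhat (of_real lam * z))) holomorphic_on U"
    by (rule holomorphic_on_compose_gen[OF holomorphic_on_subset[OF inner] holomorphic_fhat,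
          unfolded o_def])
      (auto simp: U_def)
  then have hol: "h holomorphic_on U"
    unfolding h_def by (intro holomorphic_intros)
  have "0 \<in> U"
    using T(2) in_What[of 0] by (simp add: U_def)
  define U0 where "U0 = connected_component_set U 0"
  have U0: "open U0" "connected U0" "0 \<in> U0" "U0 \<subseteq> U"
    using \<open>open U\<close> \<open>0 \<in> U\<close> 
    by (auto simp: U0_def open_connected_component connected_component_refl connected_component_subset)
  have TU: "T \<subseteq> U0"
    unfolding U0_def using T in_What by (intro connected_component_maximal) (auto simp: U_def)
  \<comment> \<open>Near \<open>0\<close> the arguments \<open>lam * z\<close> and
    \<open>f (lam * z)\<close> are close to \<open>0\<close> and to \<open>f 0 = 1\<close>. Both
    points lie in the open set \<open>W\<close>, where \<open>fhat\<close> is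
    \<open>f\<close>.\<close>
  have lim0: "((\<lambda>z. of_real lam * z) \<longlongrightarrow> 0) (nhds (0::complex))"
    using tendsto_mult_left[OF filterlim_ident, of "complex_of_real lam" 0] by simp
  have f0: "(f \<longlongrightarrow> 1) (nhds 0)"
    using isCont_f_0 f_0 by (metis continuous_at tendsto_at_iff_tendsto_nhds)
  have "\<forall>\<^sub>F z in nhds 0. z \<in> U0 \<and> z \<in> W \<and> of_real lam * z \<in> W \<and> f (of_real lam * z) \<in> W
          \<and> f z = - (1 / of_real lam) * f (f (of_real lam * z))"
    by (intro eventually_conj functional_equation eventually_nhds_in_open U0 open_W zero_in_W
        topological_tendstoD[OF lim0] topological_tendstoD[OF filterlim_compose[OF f0 lim0]] one_in_W)
  then obtain V where V: "open V" "0 \<in> V" "\<And>z. z \<in> V \<Longrightarrow> z \<in> U0 \<and> z \<in> W \<and> of_real lam * z \<in> W \<and> 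
         f (of_real lam * z) \<in> W \<and> f z = - (1 / of_real lam) * f (f (of_real lam * z))"
    unfolding eventually_nhds by blast
  have "h z = f z" if "z \<in> V" for z
    using V(3)[OF that] by (auto simp: h_def fhat_eq_f)
  then have "U0 \<subseteq> What" "\<And>z. z \<in> U0 \<Longrightarrow> fhat z = h z"
    using extensionD[OF U0(1,2) holomorphic_on_subset[OF hol U0(4)] V(1)] V(2,3) by blast+
  then show "T \<subseteq> What" "z \<in> T \<Longrightarrow> fhat z = - (1 / of_real lam) * fhat (fhat (of_real lam * z))"
    using TU by (auto simp: h_def)
qed

section \<open>The real line lies in the maximal domain\<close>

text \<open>The real fixed point \<open>g\<close> has a holomorphic extension \<open>h\<close>
  around the interval. Since \<open>f\<close> and \<open>h\<close> both agree with \<open>g\<close>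
  on reals near \<open>0\<close>, \<open>h\<close> continues \<open>f\<close>.\<close>

lemma unit_interval_in_What:
  assumes "x \<in> {-1..1}"
  shows "of_real x \<in> What \<and> fhat (of_real x) \<in> of_real ` {-1..1}"
proof -
  obtain g where g: "pd_fixed_point l g" "\<forall>\<^sub>F x in nhds 0. f (complex_of_real x) = complex_of_real (g x)"
    using feig unfolding feigenbaum_map_def by blast
  then have "g ` {-1..1} \<subseteq> {-1..1}"
    by (auto simp: pd_fixed_point_def analytic_unimodal_def)
  have "\<exists>U h. open U \<and> complex_of_real ` {-1..1} \<subseteq> U \<and> h holomorphic_on U \<and>
        (\<forall>x\<in>{-1..1}. h (complex_of_real x) = complex_of_real (g x))"
    using g(1) by (simp add: pd_fixed_point_def analytic_unimodal_def)
  then obtain U h where U: "open U" "complex_of_real ` {-1..1} \<subseteq> U" "h holomorphic_on U"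
      and hg: "\<And>x. x \<in> {-1..1} \<Longrightarrow> h (complex_of_real x) = complex_of_real (g x)"
    by auto
  define U0 where "U0 = connected_component_set U 0"
  have "0 \<in> complex_of_real ` {-1..1}"
    by (intro image_eqI[of _ _ 0]) auto
  then have U0: "open U0" "connected U0" "0 \<in> U0" "U0 \<subseteq> U"
    using U(1,2)
    by (auto simp: U0_def open_connected_component connected_component_refl connected_component_subset)
  have sub: "complex_of_real ` {-1..1} \<subseteq> U0"
    unfolding U0_def
  proof (rule connected_component_maximal[OF \<open>0 \<in> complex_of_real ` {-1..1}\<close> _ U(2)])
    show "connected (complex_of_real ` {-1..1})"
      by (intro connected_continuous_image continuous_intros) auto
  qed
  have "open (U0 \<inter> W)" "0 \<in> U0 \<inter> W"
    using U0 open_W zero_in_W by auto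
  then obtain r where r: "r > 0" "ball 0 r \<subseteq> U0 \<inter> W"
    by (meson openE)
  obtain d where d: "d > 0" "\<And>x. \<bar>x\<bar> < d \<Longrightarrow> f (complex_of_real x) = complex_of_real (g x)"
    using g(2) unfolding eventually_nhds_metric by (auto simp: dist_real_def)
  \<comment> \<open>On reals in \<open>{0<..<e}\<close>, \<open>f\<close> is \<open>g\<close>
    because \<open>e \<le> d\<close>, and \<open>h\<close> is \<open>g\<close> because
    \<open>e \<le> 1\<close>. These points accumulate at \<open>0\<close>, so the identity theorem
    applies on the disc of radius \<open>r\<close>.\<close>
  define e where "e = min (min r d) 1"
  have e: "e > 0" "e \<le> r" "e \<le> d" "e \<le> 1"
    using r d by (auto simp: e_def)
  have "h z = f z" if z: "z \<in> ball 0 r" for z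
  proof -
    have "h z - f z = 0"
    proof (rule analytic_continuation[of "\<lambda>z. h z - f z" "ball 0 r" "of_real ` {0<..<e}" 0])
      show "(\<lambda>z. h z - f z) holomorphic_on ball 0 r"
        by (intro holomorphic_intros holomorphic_on_subset[OF U(3)] holomorphic_on_subset[OF holomorphic_f_W])
          (use r U0 in auto)
      show "complex_of_real ` {0<..<e} \<subseteq> ball 0 r"
        using e by auto
      show "0 islimpt complex_of_real ` {0<..<e}"
        unfolding islimpt_approachable
      proof (intro allI impI)
        fix \<epsilon> :: real assume "\<epsilon> > 0"
        then have "min e \<epsilon> / 2 \<in> {0<..<e}" "min e \<epsilon> / 2 < \<epsilon>" "min e \<epsilon> \<noteq> 0"
          using e by auto
        then show "\<exists>x'\<in>complex_of_real ` {0<..<e}. x' \<noteq> 0 \<and> dist x' 0 < \<epsilon>"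
          by (intro bexI[OF _ imageI[of "min e \<epsilon> / 2"]]) (simp_all del: of_real_divide)
      qed
      show "h z - f z = 0" if "z \<in> complex_of_real ` {0<..<e}" for z
        using that e hg d(2) by force
    qed (use z r in auto)
    then show ?thesis by simp
  qed
  then have "U0 \<subseteq> What" "\<And>z. z \<in> U0 \<Longrightarrow> fhat z = h z"
    using extensionD[OF U0(1,2) holomorphic_on_subset[OF U(3) U0(4)] open_ball, of 0 r] r by force+
  moreover have "complex_of_real x \<in> U0" "g x \<in> {-1..1}"
    using sub assms \<open>g ` {-1..1} \<subseteq> {-1..1}\<close> by blast+
  ultimately show ?thesis
    using hg[OF assms] by auto
qed

text \<open>Multiplication by \<open>lam\<close> maps each interval onto the previous one. The
  invariance under \<open>fhat\<close> belongs to the induction because the functional equation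
  evaluates \<open>fhat\<close> twice.\<close>

lemma real_interval_in_What:
  "of_real ` {- (1 / lam ^ n)..1 / lam ^ n} \<subseteq> What \<and>
   fhat ` of_real ` {- (1 / lam ^ n)..1 / lam ^ n} \<subseteq> of_real ` {- (1 / lam ^ n)..1 / lam ^ n}"
proof (induction n)
  case 0
  then show ?case
    using unit_interval_in_What by auto
next
  case (Suc n)
  define I where "I = (\<lambda>n. complex_of_real ` {- (1 / lam ^ n)..1 / lam ^ n})"
  have IH: "I n \<subseteq> What" "\<And>z. z \<in> I n \<Longrightarrow> fhat z \<in> I n"
    using Suc.IH by (auto simp: I_def)
  have iff: "z \<in> I (Suc n) \<longleftrightarrow> of_real lam * z \<in> I n" for z
  proof
    assume "z \<in> I (Suc n)"
    then obtain r where "z = of_real r" "- (1 / lam ^ Suc n) \<le> r" "r \<le> 1 / lam ^ Suc n"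
      by (auto simp: I_def)
    then show "of_real lam * z \<in> I n"
      using lam unfolding I_def by (intro image_eqI[of _ _ "lam * r"]) (simp_all add: field_simps)
  next
    assume "of_real lam * z \<in> I n"
    then obtain r where "of_real lam * z = of_real r" "- (1 / lam ^ n) \<le> r" "r \<le> 1 / lam ^ n"
      by (auto simp: I_def)
    then show "z \<in> I (Suc n)"
      using lam unfolding I_def by (intro image_eqI[of _ _ "r / lam"]) (simp_all add: field_simps)
  qed
  have "connected (I (Suc n))"
    unfolding I_def by (intro connected_continuous_image continuous_intros) auto
  moreover have "0 \<in> I (Suc n)"
    using lam unfolding I_def by (intro image_eqI[of _ _ 0]) auto
  moreover have "of_real lam * z \<in> What \<and> fhat (of_real lam * z) \<in> What" if "z \<in> I (Suc n)" for z
    using that IH by (auto simp: iff)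
  ultimately have *: "I (Suc n) \<subseteq> What"
      "\<And>z. z \<in> I (Suc n) \<Longrightarrow> fhat z = - (1 / of_real lam) * fhat (fhat (of_real lam * z))"
    using functional_equation_extends by blast+
  have "fhat z \<in> I (Suc n)" if "z \<in> I (Suc n)" for z
  proof -
    have "fhat (fhat (of_real lam * z)) \<in> I n"
      using that IH(2) by (auto simp: iff)
    then obtain r where r: "fhat (fhat (of_real lam * z)) = of_real r" "r \<in> {- (1 / lam ^ n)..1 / lam ^ n}"
      by (auto simp: I_def)
    \<comment> \<open>The interval is symmetric, which absorbs the minus sign of the functional
      equation.\<close>
    then have "- fhat (fhat (of_real lam * z)) \<in> I n"
      unfolding I_def by (intro image_eqI[of _ _ "- r"]) auto
    then show ?thesis
      using lam by (simp add: iff *(2)[OF that])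
  qed
  with *(1) show ?case
    by (auto simp: I_def)
qed

lemma real_in_What: "complex_of_real x \<in> What"
proof -
  obtain n where "\<bar>x\<bar> < (1 / lam) ^ n"
    using real_arch_pow[of "1 / lam" "\<bar>x\<bar>"] lam by auto
  then have "x \<in> {- (1 / lam ^ n)..1 / lam ^ n}"
    by (auto simp: power_one_over)
  then show ?thesis
    using real_interval_in_What[of n] by blast
qed

end

section \<open>The domain bounded by the two arcs\<close>

text \<open>
  The branch of the \<open>n\<close>-th root on the closed upper half-plane; the factor \<open>\<i>\<close> moves the cut of
  \<open>powr\<close> to the negative imaginary axis.
\<close>

definition upper_root :: "nat \<Rightarrow> complex \<Rightarrow> complex" where
  "upper_root n z = exp (\<i> * of_real (pi / (2 * n))) * (- \<i> * z) powr (1 / of_nat n)"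

text \<open>On the closed upper half-plane \<open>- \<i> * z\<close> has nonnegative real part, so
  it meets the cut only at \<open>0\<close>, where a power with positive exponent is still
  continuous.\<close>

lemma continuous_upper_root: "n > 0 \<Longrightarrow> continuous_on {z. Im z \<ge> 0} (upper_root n)"
  unfolding upper_root_def by (intro continuous_intros) auto

lemma holomorphic_upper_root: "upper_root n holomorphic_on {z. Im z > 0}"
  unfolding upper_root_def
  by (intro holomorphic_intros) (auto simp: complex_nonpos_Reals_iff)

lemma
  assumes n: "n > 0" and z: "0 < Arg z" "Arg z < pi / real n"
  shows upper_root_power: "upper_root n (z ^ n) = z"
    and Im_power_pos: "Im (z ^ n) > 0"
proof -
  define u where "u = Ln z"
  have "z \<noteq> 0"
    using z by (auto simp: Arg_zero)
  then have zu: "z = exp u" and "Im u = Arg z"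
    by (simp_all add: u_def Arg_def)
  have pw: "z ^ n = exp (of_nat n * u)"
    by (simp add: zu exp_of_nat_mult)
  have bd: "0 < real n * Im u" "real n * Im u < pi"
    using z n \<open>Im u = Arg z\<close> by (simp_all add: field_simps)
  then show "Im (z ^ n) > 0"
    unfolding pw by (simp add: Im_exp sin_gt_zero)
  \<comment> \<open>This is the principal logarithm of \<open>- \<i> * z ^ n\<close>: its imaginary
    part lies strictly between \<open>- pi / 2\<close> and \<open>pi / 2\<close>.\<close>
  define v where "v = of_nat n * u - \<i> * of_real (pi / 2)"
  have "exp v = - \<i> * z ^ n"
    unfolding v_def pw exp_diff cis_conv_exp[symmetric] by (simp add: field_simps)
  moreover have "Ln (exp v) = v"
    using bd by (intro Ln_exp) (simp_all add: v_def)
  ultimately have "(- \<i> * z ^ n) powr (1 / of_nat n) = exp (v / of_nat n)"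
    using \<open>z \<noteq> 0\<close> by (simp add: powr_def)
  moreover have "\<i> * of_real (pi / (2 * n)) + v / of_nat n = u"
    using n by (simp add: v_def field_simps)
  ultimately show "upper_root n (z ^ n) = z"
    unfolding upper_root_def by (simp add: zu flip: exp_add)
qed

lemma closure_Im_less_0: "closure {z. Im z < 0} = {z. Im z \<le> 0}"
  using closure_halfspace_lt[of \<i> 0] by (simp add: inner_complex_def)

locale feigenbaum_boundary = feigenbaum_extension +
  fixes p x1 :: complex and gam1 gam2 :: "real \<Rightarrow> complex" and \<Phi> :: "complex \<Rightarrow> complex"
  assumes simply_connected_What: "simply_connected What"
    and calW_bounded: "bounded (feig_calW lam Finv)"
    and \<Phi>: "continuous_on {z. Im z \<le> 0} \<Phi>" "\<And>z. Im z < 0 \<Longrightarrow> \<Phi> z = Finv z"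
    and Im_p: "Im p > 0"
    and f_bij: "bij_betw f W_plus {z. Im z < 0}"
    and x1: "x1 \<in> frontier W_plus" "x1 ^ l = p"
    and frontier_W_plus: "frontier W_plus = gam1 ` {0..<1} \<union> gam2 ` {0..<1} \<union> {x1}"
    and gam1: "landing_arc What x1 gam1" "fhat ` gam1 ` {0..<1} = \<real>\<^sub>\<ge>\<^sub>0"
    and gam2: "landing_arc What x1 gam2" "fhat ` gam2 ` {0..<1} = \<real>\<^sub>\<le>\<^sub>0"
begin

section \<open>The inverse branch on the closed lower half-plane\<close>

text \<open>Taking a root of \<open>\<Phi>\<close> instead of inverting \<open>f\<close> makes the
  inverse branch available, and continuous, up to the real axis.\<close>

definition psi :: "complex \<Rightarrow> complex" where
  "psi w = upper_root l (\<Phi> w)"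

lemma W_plusD: "z \<in> W_plus \<Longrightarrow> z \<in> W \<and> 0 < Arg z \<and> Arg z < pi / real l"
  by (auto simp: feig_W_plus_def)

lemma psi_f:
  assumes "z \<in> W_plus"
  shows "Im (f z) < 0" "psi (f z) = z" "Im (\<Phi> (f z)) > 0"
proof -
  show "Im (f z) < 0"
    using f_bij assms by (auto simp: bij_betw_def)
  then have *: "\<Phi> (f z) = z ^ l"
    using Finv_f[of z] W_plusD[OF assms] by (simp add: \<Phi>(2))
  show "psi (f z) = z" "Im (\<Phi> (f z)) > 0"
    unfolding psi_def * using W_plusD[OF assms] l_ge by (auto intro: upper_root_power Im_power_pos)
qed

lemma psi_in_W_plus:
  assumes "Im w < 0"
  shows "psi w \<in> W_plus" "f (psi w) = w" "Im (\<Phi> w) > 0"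
proof -
  obtain z where z: "z \<in> W_plus" "f z = w"
    using bij_betw_imp_surj_on[OF f_bij] assms by (metis (mono_tags, lifting) imageE mem_Collect_eq)
  then show "psi w \<in> W_plus" "f (psi w) = w" "Im (\<Phi> w) > 0"
    using psi_f[OF z(1)] by auto
qed

lemma continuous_psi: "continuous_on {w. Im w \<le> 0} psi"
  unfolding psi_def
proof (rule continuous_on_compose2[OF continuous_upper_root \<Phi>(1)])
  have "Im (\<Phi> w) \<ge> 0" if "Im w \<le> 0" for w
  proof (rule continuous_ge_on_closure[where S = "{z. Im z < 0}" and f = "\<lambda>w. Im (\<Phi> w)"])
    show "continuous_on (closure {z. Im z < 0}) (\<lambda>w. Im (\<Phi> w))"
      unfolding closure_Im_less_0 by (intro continuous_intros \<Phi>(1))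
  qed (use that psi_in_W_plus(3) in \<open>auto simp: closure_Im_less_0 less_imp_le\<close>)
  then show "\<Phi> ` {w. Im w \<le> 0} \<subseteq> {z. Im z \<ge> 0}"
    by auto
qed (use l_ge in simp)

lemma holomorphic_psi: "psi holomorphic_on {w. Im w < 0}"
proof -
  have "{w. Im w < 0} \<subseteq> slit_plane lam"
    by (auto simp: slit_plane_def)
  then have "\<Phi> holomorphic_on {w. Im w < 0}"
    by (intro holomorphic_transform[OF holomorphic_on_subset[OF holomorphic_Finv]]) (auto simp: \<Phi>(2))
  then show ?thesis
    unfolding psi_def[abs_def]
    by (rule holomorphic_on_compose_gen[OF _ holomorphic_upper_root, unfolded o_def])
      (auto simp: psi_in_W_plus)
qed

lemma W_plus_subset_What: "W_plus \<subseteq> What"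
  using W_plusD W_subset_What by blast

lemma W_plus_Im_pos: "z \<in> W_plus \<Longrightarrow> Im z > 0"
proof -
  assume "z \<in> W_plus"
  then have "0 < Arg z" "Arg z < pi / real l"
    using W_plusD by auto
  moreover have "pi / real l < pi"
    using l_ge by (simp add: field_simps)
  ultimately show "Im z > 0"
    using Arg_lt_pi[of z] by linarith
qed

lemma gam_frontier:
  assumes "t \<in> {0..<1}" "\<gamma> = gam1 \<or> \<gamma> = gam2"
  shows "\<gamma> t \<in> frontier W_plus" "\<gamma> t \<noteq> x1"
proof -
  show "\<gamma> t \<in> frontier W_plus"
    using assms unfolding frontier_W_plus by auto
  have "inj_on \<gamma> {0..1}" "\<gamma> 1 = x1"
    using assms(2) landing_arcD[OF gam1(1)] landing_arcD[OF gam2(1)] by auto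
  then show "\<gamma> t \<noteq> x1"
    using assms(1) inj_onD[of \<gamma> "{0..1}" t 1] by auto
qed

text \<open>For points \<open>s n\<close> of \<open>W_plus\<close> tending to \<open>z\<close>, the
  identity \<open>psi (f (s n)) = s n\<close> passes to the limit, as \<open>psi\<close> is
  continuous up to the real value \<open>fhat z\<close>. Thus \<open>fhat\<close> is injective on
  the frontier without \<open>x1\<close>.\<close>

lemma frontier_W_plus_psi:
  assumes z: "z \<in> frontier W_plus" "z \<noteq> x1"
  shows "z \<in> What" "fhat z \<in> \<real>" "psi (fhat z) = z"
proof -
  have "z \<in> gam1 ` {0..<1} \<or> z \<in> gam2 ` {0..<1}"
    using z unfolding frontier_W_plus by auto
  then have "z \<in> What \<and> (fhat z \<in> \<real>\<^sub>\<ge>\<^sub>0 \<or> fhat z \<in> \<real>\<^sub>\<le>\<^sub>0)"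
  proof
    assume "z \<in> gam1 ` {0..<1}"
    then show ?thesis using gam1 unfolding landing_arc_def by blast
  next
    assume "z \<in> gam2 ` {0..<1}"
    then show ?thesis using gam2 unfolding landing_arc_def by blast
  qed
  then show "z \<in> What" and real: "fhat z \<in> \<real>"
    by (auto simp: nonneg_Reals_subset_Reals[THEN subsetD] nonpos_Reals_subset_Reals[THEN subsetD])
  have "z \<in> closure W_plus"
    using z by (simp add: frontier_def)
  then obtain s where s: "\<And>n. s n \<in> W_plus" "s \<longlonglongrightarrow> z"
    by (auto simp: closure_sequential)
  have "(\<lambda>n. fhat (s n)) \<longlonglongrightarrow> fhat z"
    by (rule continuous_on_tendsto_compose[OF continuous_fhat s(2) \<open>z \<in> What\<close>])
      (use s(1) W_plus_subset_What in \<open>blast intro: always_eventually\<close>)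
  moreover have "fhat (s n) = f (s n)" for n
    using fhat_eq_f W_plusD s(1) by blast
  ultimately have "(\<lambda>n. f (s n)) \<longlonglongrightarrow> fhat z"
    by simp
  then have "(\<lambda>n. psi (f (s n))) \<longlonglongrightarrow> psi (fhat z)"
    by (rule continuous_on_tendsto_compose[OF continuous_psi])
      (use real psi_f(1)[OF s(1)] in \<open>auto simp: complex_is_Real_iff less_imp_le\<close>)
  then have "s \<longlonglongrightarrow> psi (fhat z)"
    by (simp add: psi_f(2) s(1))
  then show "psi (fhat z) = z"
    using s(2) LIMSEQ_unique by blast
qed

text \<open>Together the arcs realise every real value of \<open>fhat\<close>, and
  \<open>psi\<close> sends each value back to the frontier point where it is taken.\<close>

lemma psi_real: "psi (of_real x) \<in> frontier W_plus" "psi (of_real x) \<noteq> x1"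
  and fhat_psi_real: "fhat (psi (of_real x)) = of_real x"
proof -
  have "complex_of_real x \<in> \<real>\<^sub>\<ge>\<^sub>0 \<or> complex_of_real x \<in> \<real>\<^sub>\<le>\<^sub>0"
    by auto
  then have "\<exists>\<gamma> t. (\<gamma> = gam1 \<or> \<gamma> = gam2) \<and> t \<in> {0..<1} \<and> fhat (\<gamma> t) = of_real x"
  proof
    assume "complex_of_real x \<in> \<real>\<^sub>\<ge>\<^sub>0"
    then obtain t where "t \<in> {0..<1}" "fhat (gam1 t) = of_real x"
      unfolding gam1(2)[symmetric] image_image by (auto elim!: imageE)
    then show ?thesis by blast
  next
    assume "complex_of_real x \<in> \<real>\<^sub>\<le>\<^sub>0"
    then obtain t where "t \<in> {0..<1}" "fhat (gam2 t) = of_real x"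
      unfolding gam2(2)[symmetric] image_image by (auto elim!: imageE)
    then show ?thesis by blast
  qed
  then obtain \<gamma> t where t: "\<gamma> = gam1 \<or> \<gamma> = gam2" "t \<in> {0..<1}" "fhat (\<gamma> t) = of_real x"
    by blast
  note fr = gam_frontier[OF t(2,1)]
  have "psi (of_real x) = \<gamma> t"
    using frontier_W_plus_psi(3)[OF fr] t(3) by simp
  then show "psi (of_real x) \<in> frontier W_plus" "psi (of_real x) \<noteq> x1" "fhat (psi (of_real x)) = of_real x"
    using fr t(3) by auto
qed

text \<open>The origin is the vertex of the sector containing \<open>W_plus\<close>, hence a
  frontier point, and \<open>f 0 = 1\<close>.\<close>

lemma psi_1: "psi 1 = 0"
proof -
  have "0 \<in> closure W_plus"
    unfolding closure_approachable
  proof (intro allI impI)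
    fix e :: real assume "e > 0"
    obtain r where r: "r > 0" "ball 0 r \<subseteq> W"
      using open_W zero_in_W openE by blast
    define d where "d = min e r / 2"
    have d: "0 < d" "d < e" "d < r"
      using r \<open>e > 0\<close> by (auto simp: d_def)
    \<comment> \<open>Points of the bisector of the sector approach its vertex from inside
      \<open>W_plus\<close>.\<close>
    define \<theta> where "\<theta> = pi / (2 * real l)"
    have \<theta>: "0 < \<theta>" "\<theta> < pi" "\<theta> < pi / real l"
      using l_ge by (simp_all add: \<theta>_def field_simps)
    define z where "z = of_real d * cis \<theta>"
    have "Arg z = \<theta>"
      using d \<theta> by (simp add: z_def Arg_times_of_real Arg_cis)
    moreover have "cmod z = d"
      using d by (simp add: z_def norm_mult)
    ultimately have "z \<in> W_plus"
      using r d \<theta> by (auto simp: feig_W_plus_def)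
    then show "\<exists>z\<in>W_plus. dist z 0 < e"
      using \<open>cmod z = d\<close> d by auto
  qed
  \<comment> \<open>By convention \<open>Arg 0 = 0\<close>, so the strict inequality excludes the
    vertex.\<close>
  moreover have "0 \<notin> W_plus"
    by (auto simp: feig_W_plus_def Arg_zero)
  ultimately have "0 \<in> frontier W_plus"
    using interior_subset by (auto simp: frontier_def)
  moreover have "0 \<noteq> x1"
    using x1(2) Im_p l_ge by (auto simp: zero_power)
  ultimately have "psi (fhat 0) = 0"
    using frontier_W_plus_psi(3) by blast
  then show ?thesis
    using fhat_eq_f[OF zero_in_W] f_0 by simp
qed

text \<open>On the curve \<open>T\<close> the functional equation evaluates \<open>fhat\<close>
  first at a frontier point \<open>psi x\<close> and then at the real number \<open>x\<close>; both
  lie in \<open>What\<close>. The curve passes through \<open>0\<close> because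
  \<open>psi 1 = 0\<close>.\<close>

lemma scaled_frontier_in_What:
  assumes "z \<in> frontier W_plus" "z \<noteq> x1"
  shows "z / of_real lam \<in> What"
proof -
  define T where "T = range (\<lambda>x. psi (complex_of_real x) / of_real lam)"
  have "continuous_on UNIV (\<lambda>x. psi (complex_of_real x))"
    by (rule continuous_on_compose2[OF continuous_psi]) (auto intro: continuous_intros)
  then have "connected T"
    unfolding T_def using lam by (intro connected_continuous_image continuous_intros) auto
  moreover have "0 \<in> T"
    unfolding T_def using psi_1 by (intro image_eqI[of _ _ 1]) auto
  ultimately have "T \<subseteq> What"
  proof (rule functional_equation_extends)
    fix z assume "z \<in> T"
    then obtain x where "of_real lam * z = psi (complex_of_real x)"
      using lam by (auto simp: T_def)
    then show "of_real lam * z \<in> What \<and> fhat (of_real lam * z) \<in> What"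
      using frontier_W_plus_psi(1)[OF psi_real] fhat_psi_real real_in_What by simp
  qed
  moreover have "z / of_real lam \<in> T"
    using frontier_W_plus_psi(2,3)[OF assms] unfolding T_def Reals_def by (metis (mono_tags) imageE rangeI)
  ultimately show ?thesis
    by blast
qed

section \<open>The obstruction at \<open>x1\<close>\<close>

text \<open>Otherwise the closed arc \<open>gam1\<close> would be a compact subset of
  \<open>What\<close>, and \<open>fhat\<close> would be bounded on it, although its values fill the
  half-line.\<close>

lemma x1_notin_What: "x1 \<notin> What"
proof
  assume "x1 \<in> What"
  have arc: "arc gam1" "gam1 ` {0..<1} \<subseteq> What" "gam1 1 = x1"
    using landing_arcD[OF gam1(1)] by simp_all
  have "{0..1} = insert 1 {0..<1::real}"
    by auto
  then have sub: "gam1 ` {0..1} \<subseteq> What"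
    using arc \<open>x1 \<in> What\<close> by auto
  have "compact (fhat ` gam1 ` {0..1})"
    using arc(1) continuous_on_subset[OF continuous_fhat sub]
    by (intro compact_continuous_image) (auto simp: arc_def path_def)
  then have "bounded (fhat ` gam1 ` {0..<1})"
    by (rule bounded_subset[OF compact_imp_bounded]) auto
  then obtain B where B: "\<And>z. z \<in> \<real>\<^sub>\<ge>\<^sub>0 \<Longrightarrow> cmod z \<le> B"
    unfolding gam1(2) bounded_iff by blast
  show False
    using B[of "of_real (\<bar>B\<bar> + 1)"] unfolding norm_of_real nonneg_Reals_of_real_iff by linarith
qed

lemma Im_x1: "Im x1 > 0"
proof -
  have "Im x1 \<ge> 0"
  proof (rule continuous_ge_on_closure[where S = W_plus and f = Im])
    show "x1 \<in> closure W_plus"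
      using x1(1) by (simp add: frontier_def)
  qed (auto intro: continuous_intros less_imp_le W_plus_Im_pos)
  moreover have "Im x1 \<noteq> 0"
  proof
    assume "Im x1 = 0"
    then have "x1 ^ l \<in> \<real>"
      by (simp add: complex_is_Real_iff[symmetric] Reals_power)
    then show False
      using x1(2) Im_p by (simp add: complex_is_Real_iff)
  qed
  ultimately show ?thesis by simp
qed

text \<open>At \<open>psi w / lam\<close> the functional equation becomes
  \<open>f w = - lam * f (psi w / lam)\<close>, valid for \<open>w\<close> near \<open>1\<close>
  below the axis. If the scaled domain were in \<open>What\<close>, the right-hand side would be
  holomorphic on the whole lower half-plane.\<close>

lemma scaled_W_plus_not_subset_What: "\<exists>z\<in>W_plus. z / of_real lam \<notin> What"
proof (rule ccontr)
  assume "\<not> ?thesis"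
  then have sub: "psi w / of_real lam \<in> What" if "Im w < 0" for w
    using psi_in_W_plus(1)[OF that] by blast
  define h where "h = (\<lambda>w. - of_real lam * fhat (psi w / of_real lam))"
  have hol: "h holomorphic_on {w. Im w < 0}"
  proof -
    have "(\<lambda>w. fhat (psi w / of_real lam)) holomorphic_on {w. Im w < 0}"
      by (rule holomorphic_on_compose_gen[OF _ holomorphic_fhat, of "\<lambda>w. psi w / of_real lam", unfolded o_def])
        (use lam sub in \<open>auto intro!: holomorphic_intros holomorphic_psi\<close>)
    then show ?thesis
      unfolding h_def by (intro holomorphic_intros)
  qed
  \<comment> \<open>As \<open>psi 1 = 0\<close>, points \<open>w\<close> near \<open>1\<close> give
    arguments near \<open>0\<close>, where the functional equation is known.\<close>
  have lim: "((\<lambda>w. psi w / of_real lam) \<longlongrightarrow> 0) (at 1 within {w. Im w \<le> 0})"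
  proof -
    have "(psi \<longlongrightarrow> psi 1) (at 1 within {w. Im w \<le> 0})"
      using continuous_psi by (auto simp: continuous_on_def)
    then show ?thesis
      using tendsto_divide[of psi 0 _ "\<lambda>_. of_real lam" "of_real lam"] lam by (simp add: psi_1)
  qed
  have "\<forall>\<^sub>F z in nhds 0. f z = - (1 / of_real lam) * f (f (of_real lam * z)) \<and> z \<in> W"
    by (intro eventually_conj functional_equation eventually_nhds_in_open open_W zero_in_W)
  from eventually_compose_filterlim[OF this lim]
  have "\<forall>\<^sub>F w in at 1 within {w. Im w \<le> 0}. f (psi w / of_real lam) =
          - (1 / of_real lam) * f (f (of_real lam * (psi w / of_real lam))) \<and> psi w / of_real lam \<in> W" .
  moreover have "\<forall>\<^sub>F w in at 1 within {w. Im w \<le> 0}. w \<in> W"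
    using eventually_nhds_in_open[OF open_W one_in_W] by (simp add: eventually_at_filter eventually_mono)
  ultimately have "\<forall>\<^sub>F w in at 1 within {w. Im w \<le> 0}. (f (psi w / of_real lam) =
          - (1 / of_real lam) * f (f (of_real lam * (psi w / of_real lam))) \<and> psi w / of_real lam \<in> W) \<and> w \<in> W"
    by (rule eventually_conj)
  then obtain d where d: "d > 0" and near: "\<And>w. Im w \<le> 0 \<Longrightarrow> w \<noteq> 1 \<Longrightarrow> dist w 1 < d \<Longrightarrow>
      f (psi w / of_real lam) = - (1 / of_real lam) * f (f (psi w)) \<and> psi w / of_real lam \<in> W \<and> w \<in> W"
    using lam unfolding eventually_at by auto
  define V where "V = ball 1 d \<inter> {w. Im w < 0}"
  have V_D: "Im w < 0" "dist w 1 < d" "w \<noteq> 1" if "w \<in> V" for w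
    using that by (auto simp: V_def dist_commute)
  have "w \<in> W" if "w \<in> V" for w
    using near[OF _ V_D(3,2)] V_D(1)[OF that] that by simp
  then have V: "V \<subseteq> W"
    by (rule subsetI)
  have h_eq: "h w = f w" if "w \<in> V" for w
    using near[OF _ V_D(3,2)] V_D(1)[OF that] that psi_in_W_plus(2) lam by (simp add: h_def fhat_eq_f)
  have "open V"
    unfolding V_def by (intro open_Int open_ball open_halfspace_Im_lt)
  have "1 - \<i> * of_real (d / 2) \<in> V"
    using d by (simp add: V_def dist_norm norm_mult)
  have "V \<noteq> {}"
    using \<open>1 - _ \<in> V\<close> by blast
  \<comment> \<open>Reflection in \<open>0\<close> carries the half-disc \<open>V\<close> at
    \<open>1\<close> to one at \<open>-1\<close> above the axis. As \<open>f\<close> is even,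
    \<open>h (- w)\<close> continues it to the upper half-plane, which contains
    \<open>x1\<close>.\<close>
  have uminus: "open (uminus ` V)" "uminus ` V \<subseteq> {w. Im w > 0}" "uminus ` V \<subseteq> W" "uminus ` V \<noteq> {}"
    using \<open>open V\<close> \<open>V \<noteq> {}\<close> subsetD[OF V] uminus_in_W V_D(1)
    by (simp_all add: open_negations image_subset_iff)
  have "(\<lambda>w. h (- w)) holomorphic_on {w. Im w > 0}"
    by (rule holomorphic_on_compose_gen[OF _ hol, of "\<lambda>w. - w", unfolded o_def])
      (auto intro!: holomorphic_intros)
  moreover have "connected {w. Im w > 0}"
    by (intro convex_connected convex_halfspace_Im_gt)
  moreover have "h (- w) = f w" if "w \<in> uminus ` V" for w
    using that subsetD[OF V] h_eq f_even by auto
  ultimately have "{w. Im w > 0} \<subseteq> What"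
    using extensionD(1)[OF open_halfspace_Im_gt _ _ uminus(1,4,3,2)] by blast
  then show False
    using x1_notin_What Im_x1 by blast
qed

section \<open>The Jordan curve formed by the scaled arcs\<close>

text \<open>Along the arc \<open>fhat\<close> is injective, since \<open>psi\<close> recovers the
  point from its value, and it takes values in a half-line with end point \<open>0\<close>. Hence
  \<open>0\<close> is taken at parameter \<open>0\<close>.\<close>

lemma gam_start:
  assumes "\<gamma> = gam1 \<or> \<gamma> = gam2"
  shows "\<gamma> 0 = psi 0"
proof -
  \<comment> \<open>The sign turns the nonpositive half-line into the nonnegative one, so that
    \<open>0\<close> is a minimum for either arc.\<close>
  define \<sigma> :: real where "\<sigma> = (if \<gamma> = gam1 then 1 else - 1)"
  define \<phi> where "\<phi> = (\<lambda>t. \<sigma> * Re (fhat (\<gamma> t)))"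
  have \<gamma>: "landing_arc What x1 \<gamma>"
    using assms gam1(1) gam2(1) by auto
  have fr: "\<gamma> t = psi (fhat (\<gamma> t))" "fhat (\<gamma> t) \<in> \<real>" if "t \<in> {0..<1}" for t
    using frontier_W_plus_psi[OF gam_frontier[OF that assms]] by auto
  have range: "fhat ` \<gamma> ` {0..<1} = (if \<gamma> = gam1 then \<real>\<^sub>\<ge>\<^sub>0 else \<real>\<^sub>\<le>\<^sub>0)"
    using assms gam1(2) gam2(2) by auto
  have "0 \<in> fhat ` \<gamma> ` {0..<1}"
    unfolding range by auto
  then obtain t where t: "t \<in> {0..<1}" "fhat (\<gamma> t) = 0"
    by auto
  have "t = 0"
  proof (rule inj_on_half_open_min_at_0[where \<phi> = \<phi>])
    have "continuous_on {0..1} \<gamma>"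
      by (rule landing_arcD[OF \<gamma>])
    then have "continuous_on {0..<1} \<gamma>"
      by (rule continuous_on_subset) auto
    then have "continuous_on {0..<1} (\<lambda>t. fhat (\<gamma> t))"
      by (rule continuous_on_compose2[OF continuous_fhat]) (rule landing_arcD[OF \<gamma>])
    then show "continuous_on {0..<1} \<phi>"
      unfolding \<phi>_def by (intro continuous_intros)
    show "inj_on \<phi> {0..<1}"
    proof (rule inj_onI)
      fix s s' assume s: "s \<in> {0..<1}" "s' \<in> {0..<1}" "\<phi> s = \<phi> s'"
      then have "Re (fhat (\<gamma> s)) = Re (fhat (\<gamma> s'))"
        by (auto simp: \<phi>_def \<sigma>_def split: if_splits)
      then have "fhat (\<gamma> s) = fhat (\<gamma> s')"
        using fr(2)[OF s(1)] fr(2)[OF s(2)] by (simp add: complex_is_Real_iff complex_eq_iff)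
      then have "\<gamma> s = \<gamma> s'"
        using fr(1)[OF s(1)] fr(1)[OF s(2)] by simp
      moreover have "inj_on \<gamma> {0..1}"
        by (rule landing_arcD[OF \<gamma>])
      ultimately show "s = s'"
        using s(1,2) by (auto dest: inj_onD)
    qed
    show "\<phi> t \<le> \<phi> s" if "s \<in> {0..<1}" for s
    proof -
      have "fhat (\<gamma> s) \<in> (if \<gamma> = gam1 then \<real>\<^sub>\<ge>\<^sub>0 else \<real>\<^sub>\<le>\<^sub>0)"
        using range that by blast
      then show ?thesis
        using t(2) by (auto simp: \<phi>_def \<sigma>_def complex_nonneg_Reals_iff complex_nonpos_Reals_iff split: if_splits)
    qed
  qed (rule t(1))
  then show ?thesis
    using fr(1)[OF t(1)] t(2) by simp
qed

lemma gam_starts: "gam1 0 = psi 0" "gam2 0 = psi 0"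
  using gam_start by blast+

text \<open>At a common point other than \<open>x1\<close> the value of \<open>fhat\<close> is both
  nonnegative and nonpositive, so the point is \<open>psi 0\<close>.\<close>

lemma gam_meet:
  assumes "t \<in> {0..1}" "s \<in> {0..1}" "gam1 t = gam2 s"
  shows "gam1 t = gam1 0 \<or> gam1 t = x1"
proof (cases "t = 1 \<or> s = 1")
  case True
  have "gam1 1 = x1" "gam2 1 = x1"
    by (rule landing_arcD[OF gam1(1)], rule landing_arcD[OF gam2(1)])
  with True assms show ?thesis by auto
next
  case False
  then have ts: "t \<in> {0..<1}" "s \<in> {0..<1}"
    using assms by auto
  have "fhat (gam1 t) \<in> \<real>\<^sub>\<ge>\<^sub>0" "fhat (gam1 t) \<in> \<real>\<^sub>\<le>\<^sub>0"
    using gam1(2) gam2(2) ts assms(3) by (metis imageI)+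
  then have "fhat (gam1 t) = 0"
    by (auto simp: complex_nonneg_Reals_iff complex_nonpos_Reals_iff complex_eq_iff)
  then show ?thesis
    using frontier_W_plus_psi(3)[OF gam_frontier[where \<gamma> = gam1, OF ts(1)]] gam_starts(1) by auto
qed

lemma bounded_W_plus: "bounded W_plus"
proof -
  obtain B where B: "\<And>z. z \<in> feig_calW lam Finv \<Longrightarrow> cmod z \<le> B"
    using calW_bounded unfolding bounded_iff by blast
  have "cmod z \<le> max 1 B" if "z \<in> W_plus" for z
  proof (cases "cmod z \<le> 1")
    case False
    then have "cmod z ^ 1 \<le> cmod z ^ l"
      using l_ge by (intro power_increasing) auto
    also have "\<dots> \<le> B"
      using W_plusD[OF that] B[of "z ^ l"] by (simp add: W_iff norm_power)
    finally show ?thesis by simp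
  qed simp
  then show ?thesis
    by (auto simp: bounded_iff)
qed

lemma landing_arc_scaled:
  assumes "\<gamma> = gam1 \<or> \<gamma> = gam2"
  shows "landing_arc What (x1 / of_real lam) (\<lambda>t. \<gamma> t / of_real lam)"
proof -
  have \<gamma>: "landing_arc What x1 \<gamma>"
    using assms gam1(1) gam2(1) by auto
  have "arc (\<lambda>t. \<gamma> t / of_real lam)"
    using \<gamma> lam unfolding landing_arc_def arc_def path_def inj_on_def
    by (auto intro!: continuous_intros)
  then show ?thesis
    using \<gamma> scaled_frontier_in_What gam_frontier[OF _ assms]
    by (auto simp: landing_arc_def pathfinish_def)
qed

text \<open>The arcs meet only at their ends, so the loop is a Jordan curve. Its image is the
  frontier of the bounded scaled \<open>W_plus\<close>, which places the point inside.\<close>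

lemma winding_number_scaled_loop:
  assumes w: "w \<in> W_plus"
  shows "winding_number ((\<lambda>t. gam1 t / of_real lam) +++ reversepath (\<lambda>t. gam2 t / of_real lam))
           (w / of_real lam) \<noteq> 0"
    (is "winding_number (?p +++ reversepath ?q) _ \<noteq> 0")
proof -
  let ?c = "\<lambda>z. z / complex_of_real lam"
  have arcs: "arc ?p" "arc ?q" "?p 1 = ?c x1" "?q 1 = ?c x1" "?p 0 = ?q 0"
    using landing_arcD[OF landing_arc_scaled[of gam1]] landing_arcD[OF landing_arc_scaled[of gam2]] gam_starts
    by simp_all
  have ends: "pathfinish ?p = pathfinish ?q" "pathstart ?p = pathstart ?q"
    unfolding pathfinish_def pathstart_def arcs(3-5) by (rule refl)+
  have "simple_path (?p +++ reversepath ?q)"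
  proof (rule simple_path_join_loop)
    show "path_image ?p \<inter> path_image (reversepath ?q) \<subseteq> {pathstart ?p, pathstart (reversepath ?q)}"
    proof
      fix z assume "z \<in> path_image ?p \<inter> path_image (reversepath ?q)"
      then have "z \<in> ?p ` {0..1}" "z \<in> ?q ` {0..1}"
        unfolding path_image_reversepath by (simp_all add: path_image_def)
      then obtain t s where ts: "t \<in> {0..1}" "s \<in> {0..1}" "z = ?c (gam1 t)" "z = ?c (gam2 s)"
        by blast
      then have "gam1 t = gam2 s"
        using lam by simp
      from gam_meet[OF ts(1,2) this] show "z \<in> {pathstart ?p, pathstart (reversepath ?q)}"
        using ts(3) arcs by (auto simp: pathstart_def pathfinish_def reversepath_def)
    qed
  qed (simp_all add: arcs arc_reversepath ends)
  moreover have "path_image (?p +++ reversepath ?q) = frontier (?c ` W_plus)"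
  proof -
    have "{0..1} = insert 1 {0..<1::real}" by auto
    then have "path_image ?p = ?c ` (insert x1 (gam1 ` {0..<1}))" "path_image ?q = ?c ` (insert x1 (gam2 ` {0..<1}))"
      using arcs(3,4) by (auto simp: path_image_def image_image)
    moreover have "path_image (?p +++ reversepath ?q) = path_image ?p \<union> path_image ?q"
      by (simp add: path_image_join ends)
    moreover have "frontier (?c ` W_plus) = ?c ` frontier W_plus"
      using lam by (intro frontier_scaled) simp
    ultimately show ?thesis
      unfolding frontier_W_plus by auto
  qed
  moreover have "?c w \<in> inside (frontier (?c ` W_plus))"
  proof (rule inside_frontier)
    show "bounded (?c ` W_plus)"
      using bounded_W_plus by (rule bounded_linear_image) (rule bounded_linear_divide)
    \<comment> \<open>\<open>fhat\<close> is real on the frontier without \<open>x1\<close>, but has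
      negative imaginary part on \<open>W_plus\<close>.\<close>
    show "?c w \<notin> frontier (?c ` W_plus)"
    proof
      assume "?c w \<in> frontier (?c ` W_plus)"
      then have "w \<in> frontier W_plus"
        using lam by (auto simp: frontier_scaled)
      moreover have "w \<noteq> x1"
        using w W_plus_subset_What x1_notin_What by blast
      ultimately have "fhat w \<in> \<real>"
        by (rule frontier_W_plus_psi(2))
      then show False
        using fhat_eq_f W_plusD[OF w] psi_f(1)[OF w] by (simp add: complex_is_Real_iff)
    qed
  qed (use w in blast)
  ultimately show ?thesis
    by (metis simple_closed_path_winding_number_inside zero_neq_one zero_neq_neg_one)
qed

section \<open>Position of the scaled landing point and separation of the accesses\<close>

text \<open>Otherwise the whole loop would lie in the simply connected \<open>What\<close>, yet it
  winds around a point of the scaled \<open>W_plus\<close> missing from \<open>What\<close>.\<close>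

lemma scaled_x1_notin_What: "x1 / of_real lam \<notin> What"
proof
  assume x1_in: "x1 / of_real lam \<in> What"
  obtain w where w: "w \<in> W_plus" "w / of_real lam \<notin> What"
    using scaled_W_plus_not_subset_What by blast
  let ?p = "\<lambda>t. gam1 t / of_real lam" and ?q = "\<lambda>t. gam2 t / of_real lam"
  have arcs: "path ?p" "path ?q" "?p 1 = x1 / of_real lam" "?q 1 = x1 / of_real lam" "?p 0 = ?q 0"
      "?p ` {0..<1} \<subseteq> What" "?q ` {0..<1} \<subseteq> What"
    using landing_arcD[OF landing_arc_scaled[of gam1]] landing_arcD[OF landing_arc_scaled[of gam2]] gam_starts
    by simp_all
  have "{0..1} = insert 1 {0..<1::real}" by auto
  then have "path_image ?p \<subseteq> What" "path_image ?q \<subseteq> What"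
    using arcs x1_in by (auto simp: path_image_def)
  moreover have ends: "pathfinish ?p = pathfinish ?q" "pathstart ?p = pathstart ?q"
    unfolding pathfinish_def pathstart_def arcs(3-5) by (rule refl)+
  ultimately have "path (?p +++ reversepath ?q)" "path_image (?p +++ reversepath ?q) \<subseteq> What"
    using arcs(1,2) by (simp_all add: path_image_join)
  moreover have "pathfinish (?p +++ reversepath ?q) = pathstart (?p +++ reversepath ?q)"
    by (simp add: ends)
  ultimately have "winding_number (?p +++ reversepath ?q) (w / of_real lam) = 0"
    using w(2) by (intro simply_connected_imp_winding_number_zero[OF simply_connected_What])
  then show False
    using winding_number_scaled_loop[OF w(1)] by simp
qed

text \<open>The same missing point serves here: equal accesses would force winding number zero
  around it. It differs from the landing point because \<open>w\<close> lies in \<open>What\<close>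
  and \<open>x1\<close> does not.\<close>

lemma scaled_arcs_different_access:
  "\<not> same_access What (x1 / of_real lam) (\<lambda>t. gam1 t / of_real lam) (\<lambda>t. gam2 t / of_real lam)"
proof
  assume same: "same_access What (x1 / of_real lam) (\<lambda>t. gam1 t / of_real lam) (\<lambda>t. gam2 t / of_real lam)"
  obtain w where w: "w \<in> W_plus" "w / of_real lam \<notin> What"
    using scaled_W_plus_not_subset_What by blast
  have "w \<noteq> x1"
    using w W_plus_subset_What x1_notin_What by blast
  then have "w / of_real lam \<noteq> x1 / of_real lam"
    using lam by simp
  then show False
    using same_access_imp_winding_number_zero[OF same simply_connected_What
        landing_arc_scaled landing_arc_scaled _ w(2)] gam_starts winding_number_scaled_loop[OF w(1)]
    by auto
qed

lemma scaled_x1_frontier: "x1 / of_real lam \<in> frontier What"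
proof -
  have la: "landing_arc What (x1 / of_real lam) (\<lambda>t. gam1 t / of_real lam)"
    by (rule landing_arc_scaled) simp
  have "(\<lambda>t. gam1 t / of_real lam) ` closure {0..<1} \<subseteq> closure What"
  proof (rule image_closure_subset)
    show "continuous_on (closure {0..<1}) (\<lambda>t. gam1 t / of_real lam)"
      using landing_arcD(3)[OF la] by simp
    show "(\<lambda>t. gam1 t / of_real lam) ` {0..<1} \<subseteq> closure What"
      using landing_arcD(5)[OF la] closure_subset by (rule order_trans)
  qed simp
  moreover have "x1 / of_real lam \<in> (\<lambda>t. gam1 t / of_real lam) ` closure {0..<1}"
    using landing_arcD(6)[OF la] by (intro image_eqI[of _ _ 1]) auto
  ultimately show ?thesis
    using scaled_x1_notin_What open_What by (auto simp: frontier_def interior_open)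
qed

end

theorem proposition4:
  fixes l :: nat and lam :: real
    and f F Finv fhat :: "complex \<Rightarrow> complex"
    and What :: "complex set"
    and p x1 :: complex
    and gam1 gam2 :: "real \<Rightarrow> complex"
  assumes l: "even l" "l \<ge> 2"
    and f: "feigenbaum_map l lam f F Finv"
    and fhat: "maximal_analytic_extension (feig_W l lam Finv) f What fhat"
    and What: "simply_connected What"
    and calW_bounded: "bounded (feig_calW lam Finv)"
    and Finv_extends: "\<exists>\<Phi>. continuous_on {z. Im z \<le> 0} \<Phi> \<and> inj_on \<Phi> {z. Im z \<le> 0} \<and>
          (\<forall>z. Im z < 0 \<longrightarrow> \<Phi> z = Finv z)"
    and Finv_at_infinity: "(Finv \<longlongrightarrow> p) (inf at_infinity (principal {z. Im z < 0}))" "Im p > 0"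
    and f_iso: "f holomorphic_on feig_W_plus l lam Finv"
          "bij_betw f (feig_W_plus l lam Finv) {z. Im z < 0}"
    and x1: "x1 \<in> frontier (feig_W_plus l lam Finv)" "x1 ^ l = p"
    and frontier_W_plus:
          "frontier (feig_W_plus l lam Finv) = gam1 ` {0..<1} \<union> gam2 ` {0..<1} \<union> {x1}"
    and gam1: "landing_arc What x1 gam1" "fhat ` gam1 ` {0..<1} = \<real>\<^sub>\<ge>\<^sub>0"
    and gam2: "landing_arc What x1 gam2" "fhat ` gam2 ` {0..<1} = \<real>\<^sub>\<le>\<^sub>0"
  shows "x1 / of_real lam \<in> frontier What \<and>
         landing_arc What (x1 / of_real lam) (\<lambda>t. gam1 t / of_real lam) \<and>
         landing_arc What (x1 / of_real lam) (\<lambda>t. gam2 t / of_real lam) \<and>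
         \<not> same_access What (x1 / of_real lam)
             (\<lambda>t. gam1 t / of_real lam) (\<lambda>t. gam2 t / of_real lam)"
proof -
  obtain \<Phi> where "continuous_on {z. Im z \<le> 0} \<Phi>" "\<And>z. Im z < 0 \<Longrightarrow> \<Phi> z = Finv z"
    using Finv_extends by blast
  then interpret feigenbaum_boundary l lam f F Finv fhat What p x1 gam1 gam2 \<Phi>
    using assms by unfold_locales auto
  show ?thesis
    using scaled_x1_frontier landing_arc_scaled scaled_arcs_different_access by blast
qed

end
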